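(* Let $K$ be a field of characteristic zero, let $a,b\in K$, and set $g_{a,b}(x)=\frac{1+ax}{1+bx}\in K[[x]]$. Let $\sum_{n\ge0}\mu_n z^n$ be the central transform of $g_{a,b}$, let $h_n=\det(\mu_{i+j})_{0\le i,j\le n}$ for $n\ge 0$, and let $H_{g_{a,b}}(x)=\sum_{n\ge0}h_nx^n\in K[[x]]$. Then $$H_{g_{a,b}}(x)=\frac{1-b(a+b)x}{1-2(1+ab)x+(a+b)^2x^2}.$$ Equivalently, $h_0=1$, $h_1=2+ab-b^2$, and $h_n=2(1+ab)h_{n-1}-(a+b)^2h_{n-2}$ for all $n\ge2$.
   Context: All power series are formal. For a commutative $\mathbb{Q}$-algebra $R$ and $g(x)\in R[[x]]$ with $g(0)=1$, the central transform of $g$ is the power series $\mathcal{C}(g)(z)=\sum_{n\ge0}\mu_n z^n\in R[[z]]$ with coefficients $$\mu_n=[x^{2n}]\left(\frac{1}{(1-x)\,g\left(\frac{x}{1-x}\right)}\left(\frac{x}{1-x}\right)^n\right),$$ where $[x^{m}]F(x)$ denotes the coefficient of $x^m$ in $F(x)$. *)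

theory Defs
  imports
    "HOL-Computational_Algebra.Formal_Power_Series"
    "Jordan_Normal_Form.Determinant"
begin

text \<open>Meaningful for \<open>fps_nth g 0 = 1\<close>; then all denominators below have constant term 1,
  so that division is multiplication by the inverse power series.\<close>

definition central_transform :: "'a::field_char_0 fps \<Rightarrow> 'a fps" where
  "central_transform g =
     Abs_fps (\<lambda>n. fps_nth
       (1 / ((1 - fps_X) * (g oo (fps_X / (1 - fps_X)))) * (fps_X / (1 - fps_X)) ^ n) (2 * n))"

text \<open>The determinant with index \<open>n\<close> has size \<open>n + 1\<close>.\<close>

definition hankel_det :: "'a::comm_ring_1 fps \<Rightarrow> nat \<Rightarrow> 'a" where
  "hankel_det m n = det (mat (n + 1) (n + 1) (\<lambda>(i, j). fps_nth m (i + j)))"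

definition hankel_series :: "'a::field_char_0 fps \<Rightarrow> 'a fps" where
  "hankel_series g = Abs_fps (\<lambda>n. hankel_det (central_transform g) n)"

definition g_ab :: "'a::field_char_0 \<Rightarrow> 'a \<Rightarrow> 'a fps" where
  "g_ab a b = (1 + fps_const a * fps_X) / (1 + fps_const b * fps_X)"

end

theory Submission imports Defs begin

text \<open>
Write \<open>c = 1 / g\<close>. The substitution \<open>t = x / (1 - x)\<close> turns the moments into
\<open>\<mu>\<^sub>n = [t^n] (1 + t)^(2n) c(t)\<close> (\<open>central_transform_nth\<close>). In other words \<open>\<mu>\<^sub>n\<close> is the constant
term of \<open>c(t) y^n\<close>, where \<open>y = 2 + t + 1/t\<close> is invariant under \<open>t \<mapsto> 1/t\<close>. So the Hankel
matrix is the Gram matrix of \<open>1, y, y^2, \<dots>\<close> for the bilinear form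
\<open>(P, Q) \<mapsto> CT (c P Q)\<close>, and its determinant does not change under a unitriangular change of
basis (\<open>det_unitriangular_congruence\<close>).

In the basis \<open>1, t + 1/t, t^2 + 1/t^2, \<dots>\<close> the Gram matrix is essentially
\<open>c\<^sub>i\<^sub>+\<^sub>j + c\<^sub>|\<^sub>i\<^sub>-\<^sub>j\<^sub>|\<close>; this much holds for every \<open>g\<close> (\<open>hankel_det_central_transform\<close>).

For \<open>g = (1 + a t) / (1 + b t)\<close> the coefficients of \<open>c\<close> form, from index 1 on, a geometric
sequence with ratio \<open>- a\<close>. Adding \<open>a\<close> times the previous basis vector to each basis vector
therefore kills everything away from the diagonal: the Gram matrix becomes tridiagonal, and
beyond the \<open>2 \<times> 2\<close> corner \<open>(1, b; b, 2 + a b)\<close> it has the constant diagonal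
\<open>2 (1 + a b)\<close> and constant off-diagonal \<open>a + b\<close> (\<open>gram_ab_entries\<close>). The three-term recurrence for
tridiagonal determinants (\<open>det_tridiagonal_Suc_Suc\<close>) is then the claimed recurrence, and the
generating function follows. No division by a Hankel determinant occurs, so parameters for
which some of them vanish need no separate treatment.
\<close>

section \<open>Moments of the central transform\<close>

lemma fps_nth_one_plus_X_power:
  "fps_nth ((1 + fps_X :: 'a::field_char_0 fps) ^ m) n = of_nat (m choose n)"
  by (simp add: fps_binomial_of_nat [symmetric] binomial_gbinomial)

text \<open>
Both sides are the binomial transform \<open>\<Sum>\<^sub>k (N choose k) f\<^sub>k\<close>. Comparing them by Pascal's rule
avoids expanding the composition: with \<open>f = f(0) + t f'\<close>, where \<open>f'\<close> is the shifted series,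
both sides satisfy \<open>A\<^sub>N\<^sub>+\<^sub>1(f) = A\<^sub>N(f) + A\<^sub>N(f')\<close>.
\<close>

lemma euler_transform_nth:
  fixes f :: "'a::field_char_0 fps"
  shows "fps_nth (inverse (1 - fps_X) * (f oo (fps_X * inverse (1 - fps_X)))) N =
         fps_nth ((1 + fps_X) ^ N * f) N"
proof (induction N arbitrary: f)
  case 0
  show ?case by (simp add: fps_compose_nth)
next
  case (Suc N)
  define v where "v = inverse (1 - fps_X :: 'a fps)"
  define A where "A = (\<lambda>f. v * (f oo (fps_X * v)))"
  define f' where "f' = fps_shift 1 f"
  have v: "(1 - fps_X) * v = 1"
    unfolding v_def by (subst mult.commute, rule inverse_mult_eq_1) simp
  have f: "f = fps_const (fps_nth f 0) + fps_X * f'"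
    unfolding f'_def by (rule fps_ext) simp
  have "f oo (fps_X * v) = fps_const (fps_nth f 0) + (fps_X * v) * (f' oo (fps_X * v))"
    by (subst f) (simp add: fps_compose_add_distrib fps_compose_mult_distrib)
  then have "(1 - fps_X) * A f = fps_const (fps_nth f 0) + fps_X * A f'"
    using v unfolding A_def by (metis (no_types, lifting) mult.assoc mult.left_neutral)
  then have "fps_nth ((1 - fps_X) * A f) (Suc N) = fps_nth (fps_const (fps_nth f 0) + fps_X * A f') (Suc N)"
    by simp
  then have "fps_nth (A f) (Suc N) = fps_nth (A f) N + fps_nth (A f') N"
    by (simp add: algebra_simps)
  also have "\<dots> = fps_nth ((1 + fps_X) ^ N * f) N + fps_nth ((1 + fps_X) ^ N * f') N"
    using Suc.IH unfolding A_def v_def by simp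
  also have "fps_nth ((1 + fps_X) ^ N * f') N = fps_nth ((1 + fps_X) ^ N * f) (Suc N)"
  proof -
    have "(1 + fps_X) ^ N * f =
        fps_const (fps_nth f 0) * (1 + fps_X) ^ N + fps_X * ((1 + fps_X) ^ N * f')"
      by (subst f) (simp add: algebra_simps)
    then show ?thesis by (simp add: fps_nth_one_plus_X_power)
  qed
  finally show ?case
    unfolding A_def v_def by (simp add: algebra_simps)
qed

text \<open>
The extra factor \<open>(x / (1 - x))^n\<close> is the image of \<open>t^n\<close> under the substitution, so the Euler
transform applies to \<open>t^n / g\<close> with \<open>N = 2n\<close>.
\<close>

lemma central_transform_nth:
  fixes g :: "'a::field_char_0 fps"
  assumes "fps_nth g 0 = 1"
  shows "fps_nth (central_transform g) n = fps_nth ((1 + fps_X) ^ (2 * n) * inverse g) n"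
proof -
  define v where "v = inverse (1 - fps_X :: 'a fps)"
  have h: "fps_X / (1 - fps_X) = fps_X * v"
    unfolding v_def by (rule fps_divide_unit) simp
  have "1 / ((1 - fps_X) * (g oo (fps_X * v))) = inverse ((1 - fps_X) * (g oo (fps_X * v)))"
    by (subst fps_divide_unit) (use assms in \<open>simp_all add: fps_compose_nth\<close>)
  also have "\<dots> = v * inverse (g oo (fps_X * v))"
    unfolding v_def by (rule fps_inverse_mult)
  also have "inverse (g oo (fps_X * v)) = inverse g oo (fps_X * v)"
    by (rule fps_inverse_compose [symmetric]) (use assms in simp_all)
  finally have "1 / ((1 - fps_X) * (g oo (fps_X * v))) * (fps_X * v) ^ n =
      v * ((fps_X ^ n * inverse g) oo (fps_X * v))"
    by (simp add: fps_compose_mult_distrib fps_compose_power [symmetric] mult_ac)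
  then have "fps_nth (central_transform g) n =
      fps_nth (v * ((fps_X ^ n * inverse g) oo (fps_X * v))) (2 * n)"
    by (simp add: central_transform_def h)
  also have "\<dots> = fps_nth (fps_X ^ n * ((1 + fps_X) ^ (2 * n) * inverse g)) (2 * n)"
    unfolding v_def euler_transform_nth by (simp add: mult_ac)
  finally show ?thesis by (simp add: fps_X_power_mult_nth)
qed


section \<open>Determinants\<close>

lemma det_unitriangular_congruence:
  fixes B M N :: "nat \<Rightarrow> nat \<Rightarrow> 'a::comm_ring_1"
  assumes diag: "\<And>i. i < n \<Longrightarrow> B i i = 1"
    and lower: "\<And>i k. i < k \<Longrightarrow> k < n \<Longrightarrow> B i k = 0"
    and M: "\<And>i j. i < n \<Longrightarrow> j < n \<Longrightarrow> M i j = (\<Sum>k<n. \<Sum>l<n. B i k * B j l * N k l)"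
  shows "det (mat n n (\<lambda>(i, j). M i j)) = det (mat n n (\<lambda>(i, j). N i j))"
proof -
  define B' where "B' = mat n n (\<lambda>(i, j). B i j)"
  define N' where "N' = mat n n (\<lambda>(i, j). N i j)"
  have B': "B' \<in> carrier_mat n n" and N': "N' \<in> carrier_mat n n"
    by (simp_all add: B'_def N'_def)
  have "mat n n (\<lambda>(i, j). M i j) = B' * N' * B'\<^sup>T"
  proof (rule eq_matI)
    fix i j assume "i < dim_row (B' * N' * B'\<^sup>T)" "j < dim_col (B' * N' * B'\<^sup>T)"
    then have ij: "i < n" "j < n" by (simp_all add: B'_def)
    have "(B' * N' * B'\<^sup>T) $$ (i, j) = (\<Sum>l<n. (\<Sum>k<n. B i k * N k l) * B j l)"
      using ij by (simp add: B'_def N'_def scalar_prod_def atLeast0LessThan)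
    also have "\<dots> = (\<Sum>k<n. \<Sum>l<n. B i k * B j l * N k l)"
      by (subst sum.swap) (simp add: sum_distrib_left sum_distrib_right mult_ac)
    finally show "mat n n (\<lambda>(i, j). M i j) $$ (i, j) = (B' * N' * B'\<^sup>T) $$ (i, j)"
      using ij M by simp
  qed (simp_all add: B'_def)
  moreover have "det B' = 1"
    using det_lower_triangular[OF _ B'] lower diag
    by (simp add: B'_def prod_list_diag_prod)
  ultimately show ?thesis
    using B' N' by (simp add: det_mult[of _ n] det_transpose N'_def)
qed

text \<open>
The continuant recurrence. Expand along the last row, then expand the minor that belongs to the
off-diagonal entry along its last column, which has a single nonzero entry.
\<close>

lemma det_tridiagonal_Suc_Suc:
  fixes f :: "nat \<Rightarrow> nat \<Rightarrow> 'a::comm_ring_1"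
  assumes tri: "\<And>i j. i + 2 \<le> j \<or> j + 2 \<le> i \<Longrightarrow> f i j = 0"
  defines "D \<equiv> (\<lambda>n. det (mat n n (\<lambda>(i, j). f i j)))"
  shows "D (Suc (Suc n)) =
         f (Suc n) (Suc n) * D (Suc n) - f n (Suc n) * f (Suc n) n * D n"
proof -
  define A where "A = mat (Suc (Suc n)) (Suc (Suc n)) (\<lambda>(i, j). f i j)"
  define E where "E = mat_delete A (Suc n) n"
  have A: "A \<in> carrier_mat (Suc (Suc n)) (Suc (Suc n))" by (simp add: A_def)
  have E: "E \<in> carrier_mat (Suc n) (Suc n)" by (simp add: E_def A_def mat_delete_def)
  have Eij: "E $$ (i, n) = f i (Suc n)" if "i < Suc n" for i
    using that by (simp add: E_def A_def mat_delete_def)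
  have "mat_delete E n n = mat n n (\<lambda>(i, j). f i j)"
    by (rule eq_matI) (auto simp: E_def A_def mat_delete_def)
  then have cofE: "cofactor E n n = D n"
    by (simp add: cofactor_def D_def)
  have "det E = (\<Sum>i<Suc n. E $$ (i, n) * cofactor E i n)"
    by (rule laplace_expansion_column[OF E]) simp
  also have "\<dots> = f n (Suc n) * D n"
    by (simp add: Eij tri cofE)
  finally have detE: "det E = f n (Suc n) * D n" .
  have "mat_delete A (Suc n) (Suc n) = mat (Suc n) (Suc n) (\<lambda>(i, j). f i j)"
    by (rule eq_matI) (auto simp: A_def mat_delete_def)
  then have "cofactor A (Suc n) (Suc n) = D (Suc n)"
    by (simp add: cofactor_def D_def)
  moreover have "cofactor A (Suc n) n = - (f n (Suc n) * D n)"
    using detE by (simp add: cofactor_def E_def)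
  moreover have "D (Suc (Suc n)) = (\<Sum>j<Suc (Suc n). A $$ (Suc n, j) * cofactor A (Suc n) j)"
    unfolding D_def A_def [symmetric] by (rule laplace_expansion_row[OF A]) simp
  moreover have "(\<Sum>j<n. A $$ (Suc n, j) * cofactor A (Suc n) j) = 0"
    by (rule sum.neutral) (auto simp: A_def tri)
  ultimately show ?thesis
    by (simp add: A_def algebra_simps)
qed


section \<open>The Hankel matrix in the Chebyshev basis\<close>

text \<open>
To stay with power series, a Laurent polynomial \<open>P\<close> in \<open>y = t + 2 + 1/t\<close> of degree \<open>k\<close> is
represented by \<open>t^k P\<close>. Thus \<open>y^k\<close> becomes \<open>(1 + t)^(2k)\<close>, while \<open>cheb k\<close> stands for
\<open>t^k + t^(-k)\<close>, a rescaled Chebyshev polynomial. At \<open>k = 0\<close> it is 1 rather than 2, so that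
every \<open>cheb k\<close> is monic in \<open>y\<close>. The constant term of \<open>c P Q\<close> becomes the
coefficient of \<open>t^(i + j)\<close> in \<open>c\<close> times the two representatives.
\<close>

definition cheb :: "nat \<Rightarrow> 'a::field_char_0 fps" where
  "cheb k = (if k = 0 then 1 else 1 + fps_X ^ (2 * k))"

text \<open>
The binomial expansion of \<open>y^i = t^(-i) (1 + t)^(2i)\<close>, folded about its middle term: the
coefficients of \<open>t^k\<close> and \<open>t^(-k)\<close> agree.
\<close>

lemma one_plus_X_power_eq_sum_cheb:
  "(1 + fps_X :: 'a::field_char_0 fps) ^ (2 * i) =
     (\<Sum>k\<le>i. of_nat (2 * i choose (i - k)) * (fps_X ^ (i - k) * cheb k))"
proof (rule fps_ext)
  fix n
  have *: "fps_nth (fps_X ^ (i - k) * cheb k :: 'a fps) n =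
      of_bool (n \<le> i \<and> k = i - n) + of_bool (i < n \<and> k = n - i)" if "k \<le> i" for k
    using that by (auto simp: cheb_def fps_X_power_mult_nth fps_X_power_nth)
  have "fps_nth (\<Sum>k\<le>i. of_nat (2 * i choose (i - k)) * (fps_X ^ (i - k) * cheb k :: 'a fps)) n =
      (\<Sum>k\<le>i. of_nat (2 * i choose (i - k)) *
         (of_bool (n \<le> i \<and> k = i - n) + of_bool (i < n \<and> k = n - i)))"
    unfolding fps_sum_nth
    by (rule sum.cong) (simp_all add: * fps_of_nat [symmetric] del: fps_of_nat)
  also have "\<dots> = (of_nat (2 * i choose n) :: 'a)"
  proof (cases "n \<le> i")
    case True
    have "(\<Sum>k\<le>i. of_nat (2 * i choose (i - k)) *
         (of_bool (n \<le> i \<and> k = i - n) + of_bool (i < n \<and> k = n - i))) =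
      (\<Sum>k\<le>i. if k = i - n then of_nat (2 * i choose (i - k)) else (0::'a))"
      by (rule sum.cong) (use True in auto)
    then show ?thesis using True by simp
  next
    case False
    have "(\<Sum>k\<le>i. of_nat (2 * i choose (i - k)) *
         (of_bool (n \<le> i \<and> k = i - n) + of_bool (i < n \<and> k = n - i))) =
      (\<Sum>k\<le>i. if k = n - i then of_nat (2 * i choose (i - k)) else (0::'a))"
      by (rule sum.cong) (use False in auto)
    also have "\<dots> = (if n \<le> 2 * i then of_nat (2 * i choose (i - (n - i))) else 0)"
      using False by auto
    also have "\<dots> = of_nat (2 * i choose n)"
    proof (cases "n \<le> 2 * i")
      case True
      then have "i - (n - i) = 2 * i - n" using False by simp
      then show ?thesis using True binomial_symmetric[of n "2 * i"] by simp
    qed (simp add: binomial_eq_0)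
    finally show ?thesis .
  qed
  finally show "fps_nth ((1 + fps_X :: 'a fps) ^ (2 * i)) n =
      fps_nth (\<Sum>k\<le>i. of_nat (2 * i choose (i - k)) * (fps_X ^ (i - k) * cheb k)) n"
    by (simp add: fps_nth_one_plus_X_power)
qed

definition cheb_gram :: "(nat \<Rightarrow> 'a::field_char_0) \<Rightarrow> nat \<Rightarrow> nat \<Rightarrow> 'a" where
  "cheb_gram c i j = c (i + j) +
     (if i = 0 \<or> j = 0 then 0 else if i = j then 2 * c 0
      else if j < i then c (i - j) else c (j - i))"

text \<open>
\<open>(t^i + t^(-i)) (t^j + t^(-j))\<close> has the exponents \<open>\<plusminus> (i + j)\<close> and \<open>\<plusminus> (i - j)\<close>. A power
series \<open>c\<close> only meets the nonpositive ones; both \<open>\<plusminus> (i - j)\<close> count when \<open>i = j\<close>, which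
accounts for the factor 2 on the diagonal.
\<close>

lemma fps_nth_mult_cheb_cheb:
  "fps_nth (c * (cheb i * cheb j)) (i + j) = cheb_gram (fps_nth c) i j"
proof -
  have "c * (cheb i * cheb j) = c" if "i = 0" "j = 0"
    using that by (simp add: cheb_def)
  moreover have "c * (cheb i * cheb j) = c + fps_X ^ (2 * i) * c" if "i \<noteq> 0" "j = 0"
    using that by (simp add: cheb_def algebra_simps)
  moreover have "c * (cheb i * cheb j) = c + fps_X ^ (2 * j) * c" if "i = 0" "j \<noteq> 0"
    using that by (simp add: cheb_def algebra_simps)
  moreover have "c * (cheb i * cheb j) =
      c + fps_X ^ (2 * i) * c + fps_X ^ (2 * j) * c + fps_X ^ (2 * i + 2 * j) * c"
    if "i \<noteq> 0" "j \<noteq> 0"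
    using that by (simp add: cheb_def algebra_simps power_add)
  ultimately show ?thesis
    by (cases "i = 0"; cases "j = 0")
       (auto simp: cheb_gram_def fps_X_power_mult_nth simp del: fps_mult_nth_0)
qed

text \<open>
The change of basis from \<open>y^i\<close> to \<open>t^k + t^(-k)\<close> has the matrix \<open>2i choose (i - k)\<close>, which is
unitriangular.
\<close>

lemma hankel_det_central_transform:
  fixes g :: "'a::field_char_0 fps"
  assumes "fps_nth g 0 = 1"
  shows "hankel_det (central_transform g) n =
         det (mat (n + 1) (n + 1) (\<lambda>(i, j). cheb_gram (fps_nth (inverse g)) i j))"
proof -
  define c where "c = inverse g"
  \<comment> \<open>The guard makes \<open>B\<close> triangular: for \<open>k > i\<close> the truncated difference \<open>i - k = 0\<close> would give the binomial coefficient 1.\<close>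
  define B :: "nat \<Rightarrow> nat \<Rightarrow> 'a" where
    "B = (\<lambda>i k. if k \<le> i then of_nat (2 * i choose (i - k)) else 0)"
  have expand: "(1 + fps_X) ^ (2 * i) = (\<Sum>k<n + 1. fps_const (B i k) * (fps_X ^ (i - k) * cheb k))"
    if "i < n + 1" for i
    unfolding one_plus_X_power_eq_sum_cheb
    by (rule sum.mono_neutral_cong_left)
       (use that in \<open>auto simp: B_def fps_of_nat\<close>)
  have moment: "fps_nth (central_transform g) (i + j) =
      (\<Sum>k<n + 1. \<Sum>l<n + 1. B i k * B j l * cheb_gram (fps_nth c) k l)"
    if "i < n + 1" "j < n + 1" for i j
  proof -
    have "fps_nth (central_transform g) (i + j) =
        fps_nth (c * ((1 + fps_X) ^ (2 * i) * (1 + fps_X) ^ (2 * j))) (i + j)"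
      by (simp add: central_transform_nth[OF assms] c_def power_add [symmetric] algebra_simps)
    also have "c * ((1 + fps_X) ^ (2 * i) * (1 + fps_X) ^ (2 * j)) =
        (\<Sum>k<n + 1. \<Sum>l<n + 1. fps_const (B i k * B j l) *
            (fps_X ^ (i - k + (j - l)) * (c * (cheb k * cheb l))))"
      unfolding expand[OF that(1)] expand[OF that(2)] sum_product
      unfolding sum_distrib_left
      by (intro sum.cong refl) (simp add: power_add mult_ac flip: fps_const_mult)
    also have "fps_nth \<dots> (i + j) =
        (\<Sum>k<n + 1. \<Sum>l<n + 1. B i k * B j l * cheb_gram (fps_nth c) k l)"
      unfolding fps_sum_nth
    proof (intro sum.cong refl)
      fix k l
      show "fps_nth (fps_const (B i k * B j l) *
            (fps_X ^ (i - k + (j - l)) * (c * (cheb k * cheb l)))) (i + j) =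
          B i k * B j l * cheb_gram (fps_nth c) k l"
      proof (cases "k \<le> i \<and> l \<le> j")
        case True
        then have "i + j - (i - k + (j - l)) = k + l" "\<not> i + j < i - k + (j - l)" by auto
        then show ?thesis
          by (simp add: fps_X_power_mult_nth fps_nth_mult_cheb_cheb)
      qed (auto simp: B_def)
    qed
    finally show ?thesis .
  qed
  show ?thesis
    unfolding hankel_det_def c_def [symmetric]
    by (rule det_unitriangular_congruence[where B = B])
       (use moment in \<open>auto simp: B_def\<close>)
qed


section \<open>Tridiagonal form\<close>

text \<open>
The Gram matrix for the basis vectors \<open>cheb i + a cheb (i - 1)\<close>, with the second summand absent
at \<open>i = 0\<close>.
\<close>

definition gram_ab :: "'a::field_char_0 \<Rightarrow> (nat \<Rightarrow> 'a) \<Rightarrow> nat \<Rightarrow> nat \<Rightarrow> 'a" where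
  "gram_ab a c i j =
     cheb_gram c i j + (if i = 0 then 0 else a * cheb_gram c (i - 1) j)
     + (if j = 0 then 0 else a * (cheb_gram c i (j - 1)
          + (if i = 0 then 0 else a * cheb_gram c (i - 1) (j - 1))))"

lemma cheb_gram_sym: "cheb_gram c i j = cheb_gram c j i"
  by (auto simp: cheb_gram_def add.commute)

lemma gram_ab_sym: "gram_ab a c i j = gram_ab a c j i"
  using cheb_gram_sym[of c] by (auto simp: gram_ab_def algebra_simps)

lemma det_cheb_gram_eq_det_gram_ab:
  "det (mat n n (\<lambda>(i, j). cheb_gram c i j)) = det (mat n n (\<lambda>(i, j). gram_ab a c i j))"
proof -
  define B where "B = (\<lambda>i k. if k = i then 1 else if i = Suc k then a else 0)"
  \<comment> \<open>\<open>B\<close> has ones on the diagonal and \<open>a\<close> just below it.\<close>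
  have row: "(\<Sum>k<n. B i k * F k) = F i + (if i = 0 then 0 else a * F (i - 1))"
    if "i < n" for i F
  proof -
    have "(\<Sum>k<n. B i k * F k) =
        (\<Sum>k<n. if k = i then F k else 0) +
        (\<Sum>k<n. if k = i - 1 then (if i = 0 then 0 else a * F k) else 0)"
      unfolding sum.distrib [symmetric] by (rule sum.cong) (auto simp: B_def)
    then show ?thesis using that by (auto simp: sum.delta)
  qed
  have "gram_ab a c i j = (\<Sum>k<n. \<Sum>l<n. B i k * B j l * cheb_gram c k l)"
    if "i < n" "j < n" for i j
  proof -
    have "(\<Sum>k<n. \<Sum>l<n. B i k * B j l * cheb_gram c k l) =
        (\<Sum>k<n. B i k * (\<Sum>l<n. B j l * cheb_gram c k l))"
      by (simp add: sum_distrib_left mult_ac)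
    also have "\<dots> = gram_ab a c i j"
      unfolding row[OF that(1)] row[OF that(2)]
      by (auto simp: gram_ab_def algebra_simps)
    finally show ?thesis by simp
  qed
  then show ?thesis
    by (intro det_unitriangular_congruence[symmetric, where B = B]) (auto simp: B_def)
qed

text \<open>
Row \<open>i \<ge> 2\<close> combined with \<open>a\<close> times row \<open>i - 1\<close> contains only sums \<open>c\<^sub>m + a c\<^sub>m\<^sub>-\<^sub>1\<close>. These
vanish for \<open>m \<ge> 2\<close>, so all of the Hankel part \<open>c\<^sub>i\<^sub>+\<^sub>j\<close> cancels, and the Toeplitz part
\<open>c\<^sub>i\<^sub>-\<^sub>j\<close> survives only near the diagonal, where it meets \<open>c\<^sub>0\<close> and \<open>c\<^sub>1\<close>.
\<close>

lemma gram_ab_entries: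
  fixes a b :: "'a::field_char_0"
  assumes c0: "c 0 = 1" and c1: "c 1 = b - a" and step: "\<And>n. n \<ge> 1 \<Longrightarrow> c (Suc n) = - a * c n"
  shows gram_ab_far: "j + 2 \<le> i \<Longrightarrow> gram_ab a c i j = 0"
    and gram_ab_subdiagonal: "i \<ge> 1 \<Longrightarrow> gram_ab a c (Suc i) i = a + b"
    and gram_ab_diagonal: "i \<ge> 2 \<Longrightarrow> gram_ab a c i i = 2 * (1 + a * b)"
    and gram_ab_corner: "gram_ab a c 0 0 = 1" "gram_ab a c 1 0 = b" "gram_ab a c 1 1 = 2 + a * b"
proof -
  \<comment> \<open>The row operation alone; it already gives zeros below the subdiagonal.\<close>
  define r where "r = (\<lambda>i j. cheb_gram c i j + a * cheb_gram c (i - 1) j)"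
  have gram: "gram_ab a c i j = r i j + (if j = 0 then 0 else a * r i (j - 1))" if "i \<ge> 1" for i j
    using that by (simp add: gram_ab_def r_def algebra_simps)
  have cancel: "c m + a * c (m - 1) = 0" if "m \<ge> 2" for m
    using step[of "m - 1"] that by (simp add: Suc_diff_Suc numeral_2_eq_2)
  have r0: "r i j = 0" if "j + 2 \<le> i" for i j
  proof (cases "j = 0")
    case True
    then show ?thesis using that cancel[of i] by (simp add: r_def cheb_gram_def)
  next
    case False
    then have "r i j = (c (i + j) + a * c (i + j - 1)) + (c (i - j) + a * c (i - j - 1))"
      using that by (auto simp: r_def cheb_gram_def algebra_simps)
    then show ?thesis using that cancel[of "i + j"] cancel[of "i - j"] by simp
  qed
  have r1: "r (Suc i) i = a + b" if "i \<ge> 1" for i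
  proof -
    have "r (Suc i) i = (c (Suc i + i) + a * c (Suc i + i - 1)) + (c 1 + 2 * a * c 0)"
      using that by (auto simp: r_def cheb_gram_def algebra_simps)
    then show ?thesis using that cancel[of "Suc i + i"] c1 by (simp add: c0)
  qed
  have r2: "r i i = 2 + a * (b - a)" if "i \<ge> 2" for i
  proof -
    have "r i i = (c (i + i) + a * c (i + i - 1)) + (2 * c 0 + a * c 1)"
      using that by (auto simp: r_def cheb_gram_def algebra_simps)
    then show ?thesis using that cancel[of "i + i"] c1 by (simp add: c0)
  qed
  show "gram_ab a c i j = 0" if "j + 2 \<le> i"
    using that r0[of j i] r0[of "j - 1" i] by (subst gram) auto
  show "gram_ab a c (Suc i) i = a + b" if "i \<ge> 1"
    using that r1[of i] r0[of "i - 1" "Suc i"] by (subst gram) auto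
  show "gram_ab a c i i = 2 * (1 + a * b)" if "i \<ge> 2"
    using that r2[of i] r1[of "i - 1"] by (subst gram) (auto simp: algebra_simps)
  show "gram_ab a c 0 0 = 1" "gram_ab a c 1 0 = b" "gram_ab a c 1 1 = 2 + a * b"
    using c0 c1 step[of 1]
    by (simp_all add: gram_ab_def cheb_gram_def numeral_2_eq_2 algebra_simps)
qed


section \<open>The Hankel determinants\<close>

lemma inverse_g_ab_coeffs:
  fixes a b :: "'a::field_char_0"
  defines "c \<equiv> fps_nth (inverse (g_ab a b))"
  shows "fps_nth (g_ab a b) 0 = 1" "c 0 = 1" "c 1 = b - a"
    and "n \<ge> 1 \<Longrightarrow> c (Suc n) = - a * c n"
proof -
  let ?n = "1 + fps_const a * fps_X" and ?d = "1 + fps_const b * fps_X"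
  have g: "g_ab a b = ?n * inverse ?d"
    unfolding g_ab_def by (rule fps_divide_unit) simp
  show "fps_nth (g_ab a b) 0 = 1" by (simp add: g)
  have "inverse (g_ab a b) = inverse ?n * ?d"
    by (simp add: g fps_inverse_mult)
  then have eq: "?n * inverse (g_ab a b) = ?d"
    using inverse_mult_eq_1'[of ?n] by (simp flip: mult.assoc)
  have nth: "fps_nth (?n * inverse (g_ab a b)) m = fps_nth ?d m" for m
    by (simp only: eq)
  show c0: "c 0 = 1" using nth[of 0] by (simp add: c_def)
  show "c 1 = b - a"
    using nth[of 1] c0 by (simp add: c_def algebra_simps)
  show "c (Suc n) = - a * c n" if "n \<ge> 1"
    using nth[of "Suc n"] that by (simp add: c_def algebra_simps eq_neg_iff_add_eq_0)
qed

theorem theorem1p5: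
  fixes a b :: "'a::field_char_0"
  defines "h \<equiv> hankel_det (central_transform (g_ab a b))"
  shows "hankel_series (g_ab a b) =
           (1 - fps_const (b * (a + b)) * fps_X) /
           (1 - fps_const (2 * (1 + a * b)) * fps_X + fps_const ((a + b)^2) * fps_X^2)
         \<and> h 0 = 1
         \<and> h 1 = 2 + a * b - b^2
         \<and> (\<forall>n\<ge>2. h n = 2 * (1 + a * b) * h (n - 1) - (a + b)^2 * h (n - 2))"
proof -
  define c where "c = fps_nth (inverse (g_ab a b))"
  note c = inverse_g_ab_coeffs[where a = a and b = b, folded c_def]
  note entries = gram_ab_entries[where c = c and a = a and b = b, OF c(2) c(3) c(4)]
  define D where "D = (\<lambda>n. det (mat n n (\<lambda>(i, j). gram_ab a c i j)))"
  have h: "h n = D (Suc n)" for n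
    unfolding h_def D_def hankel_det_central_transform[OF c(1)] c_def [symmetric]
    by (subst det_cheb_gram_eq_det_gram_ab) simp
  have tri: "gram_ab a c i j = 0" if "i + 2 \<le> j \<or> j + 2 \<le> i" for i j
    using that entries(1) gram_ab_sym by metis
  have D: "D (Suc (Suc n)) = gram_ab a c (Suc n) (Suc n) * D (Suc n)
      - (gram_ab a c (Suc n) n)\<^sup>2 * D n" for n
    unfolding D_def
    by (subst det_tridiagonal_Suc_Suc)
       (simp_all add: tri gram_ab_sym[of a c n "Suc n"] power2_eq_square)
  have D0: "D 0 = 1" by (simp add: D_def)
  have D1: "D 1 = 1" by (simp add: D_def det_single entries(4))
  have h0: "h 0 = 1" using D1 by (simp add: h)
  have h1: "h 1 = 2 + a * b - b\<^sup>2"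
    using D[of 0] D0 D1 entries(5,6) by (simp add: h)
  have rec: "h (Suc (Suc n)) = 2 * (1 + a * b) * h (Suc n) - (a + b)\<^sup>2 * h n" for n
    using D[of "Suc n"] entries(2)[of "Suc n"] entries(3)[of "Suc (Suc n)"] by (simp add: h)
  \<comment> \<open>The recurrence and the initial values say that \<open>H\<close> times the denominator is the numerator.\<close>
  let ?num = "1 - fps_const (b * (a + b)) * fps_X"
  let ?den = "1 - fps_const (2 * (1 + a * b)) * fps_X + fps_const ((a + b)^2) * fps_X^2"
  define H where "H = hankel_series (g_ab a b)"
  have H: "fps_nth H n = h n" for n
    by (simp add: H_def hankel_series_def h_def)
  have "H * ?den = ?num"
  proof (rule fps_ext)
    fix n
    have "H * ?den = H - fps_const (2 * (1 + a * b)) * (fps_X * H)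
        + fps_const ((a + b)^2) * (fps_X * (fps_X * H))"
      by (simp add: algebra_simps power2_eq_square del: fps_const_mult fps_const_add)
    then have "fps_nth (H * ?den) n = fps_nth (H - fps_const (2 * (1 + a * b)) * (fps_X * H)
        + fps_const ((a + b)^2) * (fps_X * (fps_X * H))) n"
      by simp
    also have "\<dots> = fps_nth ?num n"
    proof (cases n)
      case 0
      then show ?thesis using h0 by (simp add: H)
    next
      case (Suc m)
      show ?thesis
      proof (cases m)
        case 0
        then show ?thesis using Suc h0 h1
          by (simp add: H algebra_simps power2_eq_square del: fps_const_mult fps_const_add)
      next
        case (Suc k)
        then show ?thesis using \<open>n = Suc m\<close> rec[of k]
          by (simp add: H del: fps_const_mult fps_const_add)
      qed
    qed
    finally show "fps_nth (H * ?den) n = fps_nth ?num n" .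
  qed
  then have "H * ?den / ?den = ?num / ?den" by simp
  moreover have "?den \<noteq> 0"
  proof
    assume "?den = 0"
    then have "fps_nth ?den 0 = 0" by simp
    then show False by simp
  qed
  ultimately have "H = ?num / ?den" by simp
  moreover have "\<forall>n\<ge>2. h n = 2 * (1 + a * b) * h (n - 1) - (a + b)^2 * h (n - 2)"
  proof (intro allI impI)
    fix n :: nat assume "2 \<le> n"
    then obtain m where "n = Suc (Suc m)" by (metis Suc_le_D numeral_2_eq_2 Suc_le_mono)
    then show "h n = 2 * (1 + a * b) * h (n - 1) - (a + b)^2 * h (n - 2)"
      using rec[of m] by simp
  qed
  ultimately show ?thesis using h0 h1 by (simp add: H_def)
qed

end
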